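(* Let $\Phi$ be an irreducible crystallographic root system with positive system $\Phi^+$. Let $\mathcal{I}$, $\mathcal{SC}$, $\mathcal{C}$ denote respectively the set of ideals of $\Phi^+$, the set of strongly compatible subsets of $\Phi^+$, and the set of Worpitzky-compatible subsets of $\Phi^+$. Then $\mathcal{I}\subseteq\mathcal{SC}\subseteq\mathcal{C}$.
   Context: $V$ is an $\ell$-dimensional Euclidean space with inner product $(\cdot,\cdot)$, $\Phi\subseteq V$ an irreducible crystallographic root system, $\Phi^+$ a positive system with simple roots $\Delta=\{\alpha_1,\dots,\alpha_\ell\}$. For $\alpha\in\Phi$, $m\in\mathbb{Z}$, $H_{\alpha,m}=\{x\in V\mid(\alpha,x)=m\}$. Partial order on $\Phi^+$: $\beta_1\ge\beta_2$ iff $\beta_1-\beta_2\in\sum_i\mathbb{Z}_{\ge0}\alpha_i$. An ideal is a subset $\Psi\subseteq\Phi^+$ such that $\beta_1\ge\beta_2$, $\beta_1\in\Psi$, $\beta_2\in\Phi^+$ imply $\beta_2\in\Psi$. $\Psi\subseteq\Phi^+$ is strongly compatible if for every $\alpha\in\Psi$ and any positive roots $\beta_1,\dots,\beta_m\in\Phi^+$ with $\alpha\in\sum_{i=1}^m\mathbb{Z}_{>0}\beta_i$, some $\beta_k\in\Psi$. An alcove is a connected component of $V\setminus\bigcup_{\alpha\in\Phi^+,m\in\mathbb{Z}}H_{\alpha,m}$; walls of $A$ are hyperplanes supporting a facet of $A$; ceilings are walls not through the origin with the origin on the same side as $A$; the upper closure $A^\diamondsuit$ is $A$ together with its facets supported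 by ceilings. $P^\diamondsuit=\{x\in V\mid 0<(\alpha_i,x)\le1,\ 1\le i\le\ell\}$. $\Psi\subseteq\Phi^+$ is Worpitzky-compatible if for every alcove $A\subseteq P^\diamondsuit$, every $\alpha\in\Psi$, $m\in\mathbb{Z}$, the set $A^\diamondsuit\cap H_{\alpha,m}$ is empty or contained in a ceiling $H_{\beta,m'}$ of $A$ with $\beta\in\Psi$, $m'\in\mathbb{Z}$. *)

theory Defs
  imports "HOL-Analysis.Analysis"
begin

text \<open>The ambient Euclidean space \<open>V\<close> is an arbitrary type of class \<open>euclidean_space\<close>; its
  dimension is \<open>DIM('a)\<close>. Root systems are reduced.\<close>

definition reflection :: "'a::euclidean_space \<Rightarrow> 'a \<Rightarrow> 'a" where
  "reflection \<alpha> x = x - (2 * (\<alpha> \<bullet> x) / (\<alpha> \<bullet> \<alpha>)) *\<^sub>R \<alpha>"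

definition crystallographic_root_system :: "'a::euclidean_space set \<Rightarrow> bool" where
  "crystallographic_root_system \<Phi> \<longleftrightarrow>
     finite \<Phi> \<and> 0 \<notin> \<Phi> \<and> span \<Phi> = UNIV \<and>
     (\<forall>\<alpha>\<in>\<Phi>. \<Phi> \<inter> range (\<lambda>c::real. c *\<^sub>R \<alpha>) = {\<alpha>, -\<alpha>}) \<and>
     (\<forall>\<alpha>\<in>\<Phi>. reflection \<alpha> ` \<Phi> = \<Phi>) \<and>
     (\<forall>\<alpha>\<in>\<Phi>. \<forall>\<beta>\<in>\<Phi>. 2 * (\<alpha> \<bullet> \<beta>) / (\<alpha> \<bullet> \<alpha>) \<in> \<int>)"

definition irreducible_root_system :: "'a::euclidean_space set \<Rightarrow> bool" where
  "irreducible_root_system \<Phi> \<longleftrightarrow>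
     \<Phi> \<noteq> {} \<and>
     \<not> (\<exists>\<Phi>\<^sub>1 \<Phi>\<^sub>2. \<Phi>\<^sub>1 \<noteq> {} \<and> \<Phi>\<^sub>2 \<noteq> {} \<and> \<Phi>\<^sub>1 \<inter> \<Phi>\<^sub>2 = {} \<and> \<Phi> = \<Phi>\<^sub>1 \<union> \<Phi>\<^sub>2 \<and>
           (\<forall>\<alpha>\<in>\<Phi>\<^sub>1. \<forall>\<beta>\<in>\<Phi>\<^sub>2. \<alpha> \<bullet> \<beta> = 0))"

definition nonneg_int_span :: "'a::euclidean_space set \<Rightarrow> 'a set" where
  "nonneg_int_span \<Delta> = {\<Sum>\<delta>\<in>\<Delta>. real (c \<delta>) *\<^sub>R \<delta> | c :: 'a \<Rightarrow> nat. True}"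

definition simple_system :: "'a::euclidean_space set \<Rightarrow> 'a set \<Rightarrow> bool" where
  "simple_system \<Phi> \<Delta> \<longleftrightarrow>
     \<Delta> \<subseteq> \<Phi> \<and> independent \<Delta> \<and> span \<Delta> = UNIV \<and>
     (\<forall>\<alpha>\<in>\<Phi>. \<alpha> \<in> nonneg_int_span \<Delta> \<or> -\<alpha> \<in> nonneg_int_span \<Delta>)"

text \<open>Every positive system is of the following form for exactly one simple system \<open>\<Delta>\<close>,
  so positive systems are represented by their simple roots.\<close>

definition positive_roots :: "'a::euclidean_space set \<Rightarrow> 'a set \<Rightarrow> 'a set" where
  "positive_roots \<Phi> \<Delta> = \<Phi> \<inter> nonneg_int_span \<Delta>"

definition root_ge :: "'a::euclidean_space set \<Rightarrow> 'a \<Rightarrow> 'a \<Rightarrow> bool" where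
  "root_ge \<Delta> \<beta>\<^sub>1 \<beta>\<^sub>2 \<longleftrightarrow> \<beta>\<^sub>1 - \<beta>\<^sub>2 \<in> nonneg_int_span \<Delta>"

definition root_ideals :: "'a::euclidean_space set \<Rightarrow> 'a set \<Rightarrow> 'a set set" where
  "root_ideals \<Phi> \<Delta> = {\<Psi>. \<Psi> \<subseteq> positive_roots \<Phi> \<Delta> \<and>
     (\<forall>\<beta>\<^sub>1\<in>\<Psi>. \<forall>\<beta>\<^sub>2\<in>positive_roots \<Phi> \<Delta>. root_ge \<Delta> \<beta>\<^sub>1 \<beta>\<^sub>2 \<longrightarrow> \<beta>\<^sub>2 \<in> \<Psi>)}"

definition strongly_compatible_sets :: "'a::euclidean_space set \<Rightarrow> 'a set \<Rightarrow> 'a set set" where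
  "strongly_compatible_sets \<Phi> \<Delta> = {\<Psi>. \<Psi> \<subseteq> positive_roots \<Phi> \<Delta> \<and>
     (\<forall>\<alpha>\<in>\<Psi>. \<forall>(m::nat) (\<beta> :: nat \<Rightarrow> 'a).
        (\<forall>i\<in>{1..m}. \<beta> i \<in> positive_roots \<Phi> \<Delta>) \<and>
        (\<exists>c :: nat \<Rightarrow> nat. (\<forall>i\<in>{1..m}. 0 < c i) \<and> \<alpha> = (\<Sum>i=1..m. real (c i) *\<^sub>R \<beta> i))
        \<longrightarrow> (\<exists>k\<in>{1..m}. \<beta> k \<in> \<Psi>))}"

definition root_hyperplane :: "'a::euclidean_space \<Rightarrow> int \<Rightarrow> 'a set" where
  "root_hyperplane \<alpha> m = {x. \<alpha> \<bullet> x = of_int m}"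

definition alcoves :: "'a::euclidean_space set \<Rightarrow> 'a set \<Rightarrow> 'a set set" where
  "alcoves \<Phi> \<Delta> =
     components (UNIV - (\<Union>\<alpha>\<in>positive_roots \<Phi> \<Delta>. \<Union>m::int. root_hyperplane \<alpha> m))"

text \<open>Facets of an alcove \<open>A\<close> are the (closed) facets of \<open>closure A\<close>; the hyperplane \<open>H\<close>
  supports the facet \<open>closure A \<inter> H\<close>.\<close>

definition wall :: "'a::euclidean_space set \<Rightarrow> 'a set \<Rightarrow> bool" where
  "wall A H \<longleftrightarrow>
     (\<exists>a b. a \<noteq> 0 \<and> H = {x. a \<bullet> x = b} \<and> (\<forall>x\<in>A. a \<bullet> x \<le> b)) \<and>
     (closure A \<inter> H) facet_of closure A"

definition ceiling_of :: "'a::euclidean_space set \<Rightarrow> 'a set \<Rightarrow> bool" where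
  "ceiling_of A H \<longleftrightarrow>
     wall A H \<and> 0 \<notin> H \<and>
     (\<exists>a b. a \<noteq> 0 \<and> H = {x. a \<bullet> x = b} \<and> insert 0 A \<subseteq> {x. a \<bullet> x < b})"

text \<open>The upper closure is the half-open alcove of the Worpitzky partition
  of \<open>upper_box\<close>: non-strict inequalities for the ceilings, strict ones for the
  remaining walls. Hence points of a ceiling facet that lie on a wall which is not a ceiling
  are left out, while intersections of several ceiling facets are kept.\<close>

definition upper_closure :: "'a::euclidean_space set \<Rightarrow> 'a set" where
  "upper_closure A =
     (A \<union> \<Union>{closure A \<inter> H | H. ceiling_of A H}) - \<Union>{H. wall A H \<and> \<not> ceiling_of A H}"

definition upper_box :: "'a::euclidean_space set \<Rightarrow> 'a set" where
  "upper_box \<Delta> = {x. \<forall>\<delta>\<in>\<Delta>. 0 < \<delta> \<bullet> x \<and> \<delta> \<bullet> x \<le> 1}"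

definition worpitzky_compatible_sets :: "'a::euclidean_space set \<Rightarrow> 'a set \<Rightarrow> 'a set set" where
  "worpitzky_compatible_sets \<Phi> \<Delta> = {\<Psi>. \<Psi> \<subseteq> positive_roots \<Phi> \<Delta> \<and>
     (\<forall>A\<in>alcoves \<Phi> \<Delta>. A \<subseteq> upper_box \<Delta> \<longrightarrow>
        (\<forall>\<alpha>\<in>\<Psi>. \<forall>m::int.
           upper_closure A \<inter> root_hyperplane \<alpha> m = {} \<or>
           (\<exists>\<beta>\<in>\<Psi>. \<exists>m'::int. ceiling_of A (root_hyperplane \<beta> m') \<and>
              upper_closure A \<inter> root_hyperplane \<alpha> m \<subseteq> root_hyperplane \<beta> m')))}"

end

theory Submission imports Defs begin

text \<open>
  Let \<open>x\<close> be a point of the upper closure of an alcove \<open>A\<close> with \<open>\<alpha> \<bullet> x = m\<close>. The roots that are integral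
  at \<open>x\<close> form a root system, and those that are smaller on \<open>A\<close> than at \<open>x\<close> form a positive system
  of it. Its indecomposable elements \<open>\<beta>\<close> pair non-positively, so projecting the direction from \<open>x\<close>
  into \<open>A\<close> onto the orthogonal complement of \<open>\<beta>\<close> shows that each of them supports a facet of \<open>A\<close>.
  As \<open>x\<close> avoids the walls that are not ceilings, all of them are ceilings and positive roots,
  and \<open>\<alpha>\<close> is a combination of them with non-negative integer coefficients. Strong compatibility
  puts one of the \<open>\<beta>\<close> that occur into \<open>\<Psi>\<close>; since the \<open>\<beta>\<close> attain their maxima over the closure of
  \<open>A\<close> at \<open>x\<close>, every point of the closure with \<open>\<alpha> \<bullet> y = m\<close> lies on the ceiling of each such \<open>\<beta>\<close>.
\<close>

section \<open>Non-negative integer combinations\<close>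

lemma nonneg_int_span_add:
  assumes "u \<in> nonneg_int_span S" "v \<in> nonneg_int_span S"
  shows "u + v \<in> nonneg_int_span S"
proof -
  obtain c d :: "'a \<Rightarrow> nat" where "u = (\<Sum>\<delta>\<in>S. real (c \<delta>) *\<^sub>R \<delta>)" "v = (\<Sum>\<delta>\<in>S. real (d \<delta>) *\<^sub>R \<delta>)"
    using assms unfolding nonneg_int_span_def by blast
  then have "u + v = (\<Sum>\<delta>\<in>S. real (c \<delta> + d \<delta>) *\<^sub>R \<delta>)"
    by (simp add: sum.distrib scaleR_add_left)
  then show ?thesis unfolding nonneg_int_span_def
    by (intro CollectI exI[of _ "\<lambda>\<delta>. c \<delta> + d \<delta>"]) simp
qed

lemma nonneg_int_span_zero: "0 \<in> nonneg_int_span S"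
  unfolding nonneg_int_span_def by (intro CollectI exI[of _ "\<lambda>_. 0"]) simp

lemma nonneg_int_span_scale:
  assumes "v \<in> nonneg_int_span S"
  shows "real n *\<^sub>R v \<in> nonneg_int_span S"
  by (induction n)
    (use assms in \<open>auto simp: nonneg_int_span_zero nonneg_int_span_add scaleR_add_left\<close>)

lemma nonneg_int_span_sum:
  assumes "\<And>i. i \<in> I \<Longrightarrow> f i \<in> nonneg_int_span S"
  shows "sum f I \<in> nonneg_int_span S"
  using assms
  by (induction I rule: infinite_finite_induct) (auto simp: nonneg_int_span_zero nonneg_int_span_add)

lemma nonneg_int_span_base:
  assumes "finite S" "v \<in> S"
  shows "v \<in> nonneg_int_span S"
proof -
  have "(\<Sum>\<delta>\<in>S. real (if \<delta> = v then 1 else 0) *\<^sub>R \<delta>) = (\<Sum>\<delta>\<in>S. if \<delta> = v then \<delta> else 0)"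
    by (rule sum.cong) auto
  then have "v = (\<Sum>\<delta>\<in>S. real (if \<delta> = v then 1 else 0) *\<^sub>R \<delta>)"
    using assms by simp
  then show ?thesis unfolding nonneg_int_span_def
    by (intro CollectI exI[of _ "\<lambda>\<delta>. if \<delta> = v then 1 else 0"]) simp
qed

lemma nonneg_int_span_inner_nonneg:
  assumes "v \<in> nonneg_int_span S" "\<And>\<delta>. \<delta> \<in> S \<Longrightarrow> 0 \<le> \<delta> \<bullet> y"
  shows "0 \<le> v \<bullet> y"
proof -
  obtain c :: "'a \<Rightarrow> nat" where "v = (\<Sum>\<delta>\<in>S. real (c \<delta>) *\<^sub>R \<delta>)"
    using assms(1) unfolding nonneg_int_span_def by blast
  then show ?thesis using assms(2)
    by (auto simp: inner_sum_left intro!: sum_nonneg)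
qed

section \<open>Ideals are strongly compatible\<close>

text \<open>Every summand of a positive combination of positive roots lies below the total in the
  root order, so an ideal containing the total contains each summand; the first one serves as the
  witness.\<close>

lemma root_ideals_subset_strongly_compatible_sets:
  assumes "0 \<notin> \<Phi>"
  shows "root_ideals \<Phi> \<Delta> \<subseteq> strongly_compatible_sets \<Phi> \<Delta>"
proof
  fix \<Psi> assume I: "\<Psi> \<in> root_ideals \<Phi> \<Delta>"
  show "\<Psi> \<in> strongly_compatible_sets \<Phi> \<Delta>"
    unfolding strongly_compatible_sets_def
  proof (intro CollectI conjI ballI allI impI, goal_cases)
    case 1
    then show ?case using I by (simp add: root_ideals_def)
  next
    case (2 \<alpha> m \<beta>)
    then obtain c :: "nat \<Rightarrow> nat" where c: "\<And>i. i \<in> {1..m} \<Longrightarrow> 0 < c i"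
      and \<alpha>: "\<alpha> = (\<Sum>i=1..m. real (c i) *\<^sub>R \<beta> i)" and \<beta>: "\<And>i. i \<in> {1..m} \<Longrightarrow> \<beta> i \<in> positive_roots \<Phi> \<Delta>"
      by blast
    have "\<alpha> \<noteq> 0" using 2 I assms by (auto simp: root_ideals_def positive_roots_def)
    \<comment> \<open>For \<open>m = 0\<close> the sum is empty and \<alpha> would vanish.\<close>
    then have m: "1 \<in> {1..m}" using \<alpha> by (cases m) auto
    \<comment> \<open>One copy of \<open>\<beta> 1\<close> is split off. The subtraction in the
      naturals is exact because \<open>c 1\<close> is positive.\<close>
    have "real (c 1) *\<^sub>R \<beta> 1 = real (c 1 - 1) *\<^sub>R \<beta> 1 + \<beta> 1"
      using c[OF m] by (simp add: of_nat_diff scaleR_left_diff_distrib)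
    then have eq: "\<alpha> - \<beta> 1 = real (c 1 - 1) *\<^sub>R \<beta> 1 + (\<Sum>i\<in>{1..m}-{1}. real (c i) *\<^sub>R \<beta> i)"
      unfolding \<alpha> using m by (subst sum.remove[of _ 1]) auto
    have "root_ge \<Delta> \<alpha> (\<beta> 1)"
      unfolding root_ge_def eq
      by (intro nonneg_int_span_add nonneg_int_span_scale nonneg_int_span_sum)
        (use \<beta> m in \<open>auto simp: positive_roots_def\<close>)
    then show ?case using I 2(1) \<beta>[OF m] m unfolding root_ideals_def by blast
  qed
qed

section \<open>Cells of the affine arrangement\<close>

text \<open>The point \<open>a\<close> only records between which consecutive integers each root
  takes its values. The floors make sense for every \<open>a\<close>; the condition
  \<open>a \<in> cell P a\<close> used below says that \<open>a\<close> lies on none of the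
  hyperplanes, and then the cell is the component of the complement that contains
  \<open>a\<close>.\<close>

definition cell :: "'a::euclidean_space set \<Rightarrow> 'a \<Rightarrow> 'a set" where
  "cell P a = {y. \<forall>\<alpha>\<in>P. of_int \<lfloor>\<alpha> \<bullet> a\<rfloor> < \<alpha> \<bullet> y \<and> \<alpha> \<bullet> y < of_int \<lfloor>\<alpha> \<bullet> a\<rfloor> + 1}"

lemma cell_eq_Inter:
  "cell P a = (\<Inter>\<alpha>\<in>P. {y. \<alpha> \<bullet> y > of_int \<lfloor>\<alpha> \<bullet> a\<rfloor>} \<inter> {y. \<alpha> \<bullet> y < of_int \<lfloor>\<alpha> \<bullet> a\<rfloor> + 1})"
  by (auto simp: cell_def)

lemma convex_cell: "convex (cell P a)"
  unfolding cell_eq_Inter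
  by (intro convex_INT convex_Int convex_halfspace_lt convex_halfspace_gt)

lemma open_cell: "finite P \<Longrightarrow> open (cell P a)"
  unfolding cell_eq_Inter
  by (intro open_INT open_Int ballI open_halfspace_lt open_halfspace_gt)

text \<open>The image of \<open>S\<close> under the functional is a connected set of reals without
  integers, so it stays inside one open unit interval between integers.\<close>

lemma floor_inner_constant_on_connected:
  assumes "connected S" "a \<in> S" "y \<in> S" "\<And>z. z \<in> S \<Longrightarrow> \<alpha> \<bullet> z \<notin> \<int>"
  shows "of_int \<lfloor>\<alpha> \<bullet> a\<rfloor> < \<alpha> \<bullet> y \<and> \<alpha> \<bullet> y < of_int \<lfloor>\<alpha> \<bullet> a\<rfloor> + 1"
proof -
  have con: "connected ((\<bullet>) \<alpha> ` S)"
    using assms(1) by (intro connected_continuous_image continuous_intros)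
  have avoid: "t \<notin> (\<bullet>) \<alpha> ` S" if "t \<in> \<int>" for t
    using assms(4) that by auto
  have int: "of_int \<lfloor>\<alpha> \<bullet> a\<rfloor> \<in> (\<int>::real set)" "of_int \<lfloor>\<alpha> \<bullet> a\<rfloor> + 1 \<in> (\<int>::real set)" by auto
  have le: "of_int \<lfloor>\<alpha> \<bullet> a\<rfloor> \<le> \<alpha> \<bullet> a" "\<alpha> \<bullet> a \<le> of_int \<lfloor>\<alpha> \<bullet> a\<rfloor> + 1" by linarith+
  have mem: "\<alpha> \<bullet> a \<in> (\<bullet>) \<alpha> ` S" "\<alpha> \<bullet> y \<in> (\<bullet>) \<alpha> ` S" using assms by auto
  show ?thesis
    using connectedD_interval[OF con mem(2,1) _ le(1)] connectedD_interval[OF con mem(1,2) le(2)]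
      avoid int by (meson not_le)
qed

text \<open>The component cannot leave the cell without meeting a hyperplane. Conversely the cell is
  convex and avoids all hyperplanes, so maximality of the component absorbs it.\<close>

lemma component_eq_cell:
  assumes "A \<in> components (UNIV - (\<Union>\<alpha>\<in>P. \<Union>m::int. root_hyperplane \<alpha> m))" "a \<in> A"
  shows "A = cell P a" "a \<in> cell P a"
proof -
  let ?U = "UNIV - (\<Union>\<alpha>\<in>P. \<Union>m::int. root_hyperplane \<alpha> m)"
  have U: "?U = {y. \<forall>\<alpha>\<in>P. \<alpha> \<bullet> y \<notin> \<int>}"
    by (auto simp: root_hyperplane_def Ints_def)
  have conn: "connected A" and sub: "A \<subseteq> ?U"
    using assms in_components_connected in_components_subset by blast+
  have *: "A \<subseteq> cell P a"
  proof
    fix y assume "y \<in> A"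
    then show "y \<in> cell P a" unfolding cell_def
      using floor_inner_constant_on_connected[OF conn assms(2)] sub unfolding U by blast
  qed
  then show a: "a \<in> cell P a" using assms(2) by auto
  have "\<alpha> \<bullet> y \<notin> \<int>" if y: "y \<in> cell P a" and \<alpha>: "\<alpha> \<in> P" for \<alpha> y
  proof
    assume "\<alpha> \<bullet> y \<in> \<int>"
    then obtain n :: int where n: "\<alpha> \<bullet> y = of_int n" by (auto elim: Ints_cases)
    have "of_int \<lfloor>\<alpha> \<bullet> a\<rfloor> < (of_int n :: real)" "(of_int n :: real) < of_int (\<lfloor>\<alpha> \<bullet> a\<rfloor> + 1)"
      using y \<alpha> n unfolding cell_def by auto
    then show False by (simp only: of_int_less_iff)
  qed
  then have "cell P a \<subseteq> ?U" unfolding U by blast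
  moreover have "A \<inter> cell P a \<noteq> {}" using a assms(2) by auto
  ultimately have "cell P a \<subseteq> A"
    using components_maximal[OF assms(1)] convex_connected[OF convex_cell] by blast
  then show "A = cell P a" using * by auto
qed

lemma closure_cell:
  assumes "a \<in> cell P a"
  shows "closure (cell P a) = {y. \<forall>\<alpha>\<in>P. of_int \<lfloor>\<alpha> \<bullet> a\<rfloor> \<le> \<alpha> \<bullet> y \<and> \<alpha> \<bullet> y \<le> of_int \<lfloor>\<alpha> \<bullet> a\<rfloor> + 1}"
    (is "_ = ?C")
proof
  have "?C = (\<Inter>\<alpha>\<in>P. {y. \<alpha> \<bullet> y \<ge> of_int \<lfloor>\<alpha> \<bullet> a\<rfloor>} \<inter> {y. \<alpha> \<bullet> y \<le> of_int \<lfloor>\<alpha> \<bullet> a\<rfloor> + 1})"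
    by auto
  then have "closed ?C"
    by (simp add: closed_INT closed_Int closed_halfspace_le closed_halfspace_ge)
  then show "closure (cell P a) \<subseteq> ?C"
    by (intro closure_minimal) (auto simp: cell_def less_imp_le)
  show "?C \<subseteq> closure (cell P a)"
  proof
    fix y assume y: "y \<in> ?C"
    \<comment> \<open>Moving from \<open>y\<close> towards \<open>a\<close>, where all bounds are
      strict, makes every bound strict at once.\<close>
    let ?f = "\<lambda>t::real. (1 - t) *\<^sub>R y + t *\<^sub>R a"
    have lim: "(?f \<longlongrightarrow> (1 - 0) *\<^sub>R y + 0 *\<^sub>R a) (at_right 0)"
      by (intro tendsto_intros)
    have "?f t \<in> cell P a" if t: "0 < t" "t < 1" for t
      unfolding cell_def
    proof (intro CollectI ballI)
      fix \<alpha> assume "\<alpha> \<in> P"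
      then have l: "of_int \<lfloor>\<alpha> \<bullet> a\<rfloor> \<le> \<alpha> \<bullet> y" "\<alpha> \<bullet> y \<le> of_int \<lfloor>\<alpha> \<bullet> a\<rfloor> + 1"
        "of_int \<lfloor>\<alpha> \<bullet> a\<rfloor> < \<alpha> \<bullet> a" "\<alpha> \<bullet> a < of_int \<lfloor>\<alpha> \<bullet> a\<rfloor> + 1"
        using y assms unfolding cell_def by auto
      have "(1 - t) * of_int \<lfloor>\<alpha> \<bullet> a\<rfloor> \<le> (1 - t) * (\<alpha> \<bullet> y)" "t * of_int \<lfloor>\<alpha> \<bullet> a\<rfloor> < t * (\<alpha> \<bullet> a)"
        "(1 - t) * (\<alpha> \<bullet> y) \<le> (1 - t) * (of_int \<lfloor>\<alpha> \<bullet> a\<rfloor> + 1)" "t * (\<alpha> \<bullet> a) < t * (of_int \<lfloor>\<alpha> \<bullet> a\<rfloor> + 1)"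
        using l t by (auto intro!: mult_left_mono)
      then show "of_int \<lfloor>\<alpha> \<bullet> a\<rfloor> < \<alpha> \<bullet> ?f t \<and> \<alpha> \<bullet> ?f t < of_int \<lfloor>\<alpha> \<bullet> a\<rfloor> + 1"
        by (simp add: inner_add_right algebra_simps)
    qed
    then have "\<forall>\<^sub>F t in at_right 0. ?f t \<in> closure (cell P a)"
      using closure_subset by (intro eventually_at_rightI[of 0 1]) auto
    then show "y \<in> closure (cell P a)"
      using Lim_in_closed_set[OF closed_closure _ _ lim] by simp
  qed
qed

section \<open>Root systems\<close>

context
  fixes \<Phi> :: "'a::euclidean_space set"
  assumes cr: "crystallographic_root_system \<Phi>"
begin

lemma root_uminus: "\<alpha> \<in> \<Phi> \<Longrightarrow> -\<alpha> \<in> \<Phi>"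
  using cr unfolding crystallographic_root_system_def by blast

lemma root_nonzero: "\<alpha> \<in> \<Phi> \<Longrightarrow> \<alpha> \<noteq> 0"
  using cr unfolding crystallographic_root_system_def by auto

lemma root_scaleR:
  assumes "\<alpha> \<in> \<Phi>" "c *\<^sub>R \<alpha> \<in> \<Phi>"
  shows "c *\<^sub>R \<alpha> = \<alpha> \<or> c *\<^sub>R \<alpha> = -\<alpha>"
proof -
  have "\<Phi> \<inter> range (\<lambda>c::real. c *\<^sub>R \<alpha>) = {\<alpha>, -\<alpha>}"
    using cr assms(1) unfolding crystallographic_root_system_def by blast
  then show ?thesis using assms(2) by blast
qed

text \<open>The Cartan integers \<open>p\<close> and \<open>q\<close> are positive and have product
  less than 4, since the roots are not proportional. Hence one of them is 1, and the corresponding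
  reflection yields the difference up to sign.\<close>

lemma root_diff:
  assumes \<beta>: "\<beta> \<in> \<Phi>" and \<gamma>: "\<gamma> \<in> \<Phi>" and "\<beta> \<noteq> \<gamma>" and pos: "0 < \<beta> \<bullet> \<gamma>"
  shows "\<beta> - \<gamma> \<in> \<Phi>"
proof -
  define p q where "p = 2 * (\<beta> \<bullet> \<gamma>) / (\<beta> \<bullet> \<beta>)" and "q = 2 * (\<gamma> \<bullet> \<beta>) / (\<gamma> \<bullet> \<gamma>)"
  have refl: "reflection \<beta> \<gamma> \<in> \<Phi>" "reflection \<gamma> \<beta> \<in> \<Phi>" and int: "p \<in> \<int>" "q \<in> \<int>"
    using cr \<beta> \<gamma> unfolding crystallographic_root_system_def p_def q_def by blast+
  have n: "0 < \<beta> \<bullet> \<beta>" "0 < \<gamma> \<bullet> \<gamma>" using root_nonzero \<beta> \<gamma> by auto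
  have pq: "0 < p" "0 < q" using pos n by (auto simp: p_def q_def inner_commute)
  \<comment> \<open>Equality in Cauchy-Schwarz would make the roots proportional, hence equal or
    opposite: \<open>v\<close> is the component of \<gamma> orthogonal to \<beta>.\<close>
  have "(\<beta> \<bullet> \<gamma>)\<^sup>2 \<noteq> (\<beta> \<bullet> \<beta>) * (\<gamma> \<bullet> \<gamma>)"
  proof
    assume eq: "(\<beta> \<bullet> \<gamma>)\<^sup>2 = (\<beta> \<bullet> \<beta>) * (\<gamma> \<bullet> \<gamma>)"
    define v where "v = \<gamma> - ((\<beta> \<bullet> \<gamma>) / (\<beta> \<bullet> \<beta>)) *\<^sub>R \<beta>"
    have "v \<bullet> v = \<gamma> \<bullet> \<gamma> - (\<beta> \<bullet> \<gamma>)\<^sup>2 / (\<beta> \<bullet> \<beta>)"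
      using n by (simp add: v_def inner_diff_left inner_diff_right inner_commute power2_eq_square)
    then have "v = 0" using eq n by simp
    then have g: "\<gamma> = ((\<beta> \<bullet> \<gamma>) / (\<beta> \<bullet> \<beta>)) *\<^sub>R \<beta>" by (simp add: v_def)
    then have "\<gamma> = \<beta> \<or> \<gamma> = -\<beta>" using root_scaleR[OF \<beta>] \<gamma> by metis
    then show False using assms(3) pos n by auto
  qed
  then have "(\<beta> \<bullet> \<gamma>)\<^sup>2 < (\<beta> \<bullet> \<beta>) * (\<gamma> \<bullet> \<gamma>)"
    using Cauchy_Schwarz_ineq[of \<beta> \<gamma>] by linarith
  then have "p * q < 4"
    using n by (simp add: p_def q_def inner_commute power2_eq_square field_simps)
  moreover obtain i j :: int where ij: "p = of_int i" "q = of_int j"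
    using int by (auto elim!: Ints_cases)
  ultimately have "of_int (i * j) < (of_int 4 :: real)" by simp
  then have "i * j < 4" by (simp only: of_int_less_iff)
  moreover have "0 < i" "0 < j" using pq ij by auto
  ultimately have "i = 1 \<or> j = 1"
    using mult_mono[of 2 i 2 j] by linarith
  then show ?thesis
  proof
    assume "i = 1"
    then have "reflection \<beta> \<gamma> = \<gamma> - \<beta>" using ij(1) by (simp add: reflection_def flip: p_def)
    then show ?thesis using refl root_uminus by fastforce
  next
    assume "j = 1"
    then have "reflection \<gamma> \<beta> = \<beta> - \<gamma>" using ij(2) by (simp add: reflection_def flip: q_def)
    then show ?thesis using refl by simp
  qed
qed

section \<open>Roots integral at a point, and their indecomposable elements\<close>

text \<open>These are normals of the hyperplanes through \<open>x\<close>, oriented so that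
  \<open>a\<close> is on the negative side. For \<open>a\<close> in an alcove and \<open>x\<close>
  in its closure they form a positive system in the root system of roots integral at
  \<open>x\<close>, and \<open>indecomposables\<close> are its simple roots.\<close>

definition outward_roots :: "'a \<Rightarrow> 'a \<Rightarrow> 'a set" where
  "outward_roots x a = {\<gamma>\<in>\<Phi>. \<gamma> \<bullet> x \<in> \<int> \<and> \<gamma> \<bullet> a < \<gamma> \<bullet> x}"

definition indecomposables :: "'a \<Rightarrow> 'a \<Rightarrow> 'a set" where
  "indecomposables x a =
     {\<gamma> \<in> outward_roots x a. \<not> (\<exists>\<delta>\<in>outward_roots x a. \<exists>\<epsilon>\<in>outward_roots x a. \<gamma> = \<delta> + \<epsilon>)}"

lemma finite_roots: "finite \<Phi>"
  using cr unfolding crystallographic_root_system_def by blast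

lemma finite_outward_roots: "finite (outward_roots x a)"
  using finite_roots by (simp add: outward_roots_def)

lemma indecomposables_subset: "indecomposables x a \<subseteq> outward_roots x a"
  by (auto simp: indecomposables_def)

lemma finite_indecomposables: "finite (indecomposables x a)"
  using finite_subset[OF indecomposables_subset finite_outward_roots] .

text \<open>Both summands of a decomposable element have smaller inner product with
  \<open>x - a\<close>, because outward roots are positive there. As these values are real, the
  induction counts the outward roots of smaller value instead.\<close>

lemma outward_roots_subset_span_indecomposables:
  "\<gamma> \<in> outward_roots x a \<Longrightarrow> \<gamma> \<in> nonneg_int_span (indecomposables x a)"
proof (induction \<gamma> rule: measure_induct_rule[where
      f = "\<lambda>\<gamma>. card {\<delta> \<in> outward_roots x a. \<delta> \<bullet> (x - a) < \<gamma> \<bullet> (x - a)}"])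
  case (less \<gamma>)
  show ?case
  proof (cases "\<gamma> \<in> indecomposables x a")
    case True
    then show ?thesis by (intro nonneg_int_span_base finite_indecomposables)
  next
    case False
    then obtain \<delta> \<epsilon> where de: "\<delta> \<in> outward_roots x a" "\<epsilon> \<in> outward_roots x a" "\<gamma> = \<delta> + \<epsilon>"
      using less.prems by (auto simp: indecomposables_def)
    have pos: "0 < \<eta> \<bullet> (x - a)" if "\<eta> \<in> outward_roots x a" for \<eta>
      using that by (auto simp: outward_roots_def inner_diff_right)
    have smaller: "\<eta> \<in> nonneg_int_span (indecomposables x a)"
      if "\<eta> \<in> outward_roots x a" "\<eta> \<bullet> (x - a) < \<gamma> \<bullet> (x - a)" for \<eta>
    proof (rule less.IH[OF _ that(1)], rule psubset_card_mono)
      show "finite {\<delta> \<in> outward_roots x a. \<delta> \<bullet> (x - a) < \<gamma> \<bullet> (x - a)}"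
        using finite_outward_roots by simp
      \<comment> \<open>The inclusion is proper because \<eta> itself belongs only to the larger
        set.\<close>
      show "{\<delta> \<in> outward_roots x a. \<delta> \<bullet> (x - a) < \<eta> \<bullet> (x - a)}
          \<subset> {\<delta> \<in> outward_roots x a. \<delta> \<bullet> (x - a) < \<gamma> \<bullet> (x - a)}"
        using that by force
    qed
    show ?thesis unfolding de(3)
      using de pos[OF de(1)] pos[OF de(2)]
      by (intro nonneg_int_span_add smaller) (auto simp: inner_add_left)
  qed
qed

context
  fixes \<Delta> :: "'a set"
  assumes ss: "simple_system \<Phi> \<Delta>"
begin

lemma root_positive_cases: "\<gamma> \<in> \<Phi> \<Longrightarrow> \<gamma> \<in> positive_roots \<Phi> \<Delta> \<or> -\<gamma> \<in> positive_roots \<Phi> \<Delta>"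
  using ss root_uminus unfolding simple_system_def positive_roots_def by auto

lemma finite_positive_roots: "finite (positive_roots \<Phi> \<Delta>)"
  using finite_roots by (simp add: positive_roots_def)

section \<open>Walls of an alcove through a point of its closure\<close>

context
  fixes a x :: 'a
  assumes a: "a \<in> cell (positive_roots \<Phi> \<Delta>) a"
    and x: "x \<in> closure (cell (positive_roots \<Phi> \<Delta>) a)"
begin

abbreviation (input) "alc \<equiv> cell (positive_roots \<Phi> \<Delta>) a"

lemma closure_bounds:
  assumes "y \<in> closure alc" "\<alpha> \<in> positive_roots \<Phi> \<Delta>"
  shows "of_int \<lfloor>\<alpha> \<bullet> a\<rfloor> \<le> \<alpha> \<bullet> y" "\<alpha> \<bullet> y \<le> of_int \<lfloor>\<alpha> \<bullet> a\<rfloor> + 1"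
  using assms unfolding closure_cell[OF a] by auto

lemma base_bounds:
  assumes "\<alpha> \<in> positive_roots \<Phi> \<Delta>"
  shows "of_int \<lfloor>\<alpha> \<bullet> a\<rfloor> < \<alpha> \<bullet> a" "\<alpha> \<bullet> a < of_int \<lfloor>\<alpha> \<bullet> a\<rfloor> + 1"
  using assms a unfolding cell_def by auto

lemma integral_root_at_end:
  assumes "\<alpha> \<in> positive_roots \<Phi> \<Delta>" "\<alpha> \<bullet> x \<in> \<int>"
  shows "\<alpha> \<bullet> x = of_int \<lfloor>\<alpha> \<bullet> a\<rfloor> \<or> \<alpha> \<bullet> x = of_int \<lfloor>\<alpha> \<bullet> a\<rfloor> + 1"
proof -
  obtain n :: int where n: "\<alpha> \<bullet> x = of_int n" using assms(2) by (auto elim: Ints_cases)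
  have "of_int \<lfloor>\<alpha> \<bullet> a\<rfloor> \<le> (of_int n :: real)" "(of_int n :: real) \<le> of_int \<lfloor>\<alpha> \<bullet> a\<rfloor> + 1"
    using closure_bounds[OF x assms(1)] n by auto
  then have "n = \<lfloor>\<alpha> \<bullet> a\<rfloor> \<or> n = \<lfloor>\<alpha> \<bullet> a\<rfloor> + 1" by linarith
  then show ?thesis using n by auto
qed

text \<open>An integral value at \<open>x\<close> is an end of the unit interval that bounds the
  root on the alcove. Being larger at \<open>x\<close> than at \<open>a\<close> selects the upper
  end for a positive root, and the lower end for the negative of a negative root.\<close>

lemma outward_roots_le:
  assumes "\<gamma> \<in> outward_roots x a" "y \<in> closure alc"
  shows "\<gamma> \<bullet> y \<le> \<gamma> \<bullet> x"
proof -
  have g: "\<gamma> \<in> \<Phi>" "\<gamma> \<bullet> x \<in> \<int>" "\<gamma> \<bullet> a < \<gamma> \<bullet> x"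
    using assms(1) by (auto simp: outward_roots_def)
  consider (pos) "\<gamma> \<in> positive_roots \<Phi> \<Delta>" | (neg) "-\<gamma> \<in> positive_roots \<Phi> \<Delta>"
    using root_positive_cases g(1) by blast
  then show ?thesis
  proof cases
    case pos
    then show ?thesis
      using integral_root_at_end[OF pos g(2)] closure_bounds[OF assms(2) pos] base_bounds[OF pos] g(3)
      by linarith
  next
    case neg
    have "(-\<gamma>) \<bullet> x \<in> \<int>" using g(2) by simp
    from integral_root_at_end[OF neg this] show ?thesis
      using closure_bounds[OF assms(2) neg] base_bounds[OF neg] g(3)
      unfolding inner_minus_left by linarith
  qed
qed

lemma outward_roots_cases:
  assumes "\<gamma> \<in> \<Phi>" "\<gamma> \<bullet> x \<in> \<int>"
  shows "\<gamma> \<in> outward_roots x a \<or> -\<gamma> \<in> outward_roots x a"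
proof -
  have "\<alpha> \<bullet> x \<noteq> \<alpha> \<bullet> a" if "\<alpha> \<in> positive_roots \<Phi> \<Delta>" "\<alpha> \<bullet> x \<in> \<int>" for \<alpha>
    using integral_root_at_end[OF that] base_bounds[OF that(1)] by linarith
  from this[of \<gamma>] this[of "-\<gamma>"] have "\<gamma> \<bullet> x \<noteq> \<gamma> \<bullet> a"
    using root_positive_cases[OF assms(1)] assms(2) by auto
  then show ?thesis using assms root_uminus by (auto simp: outward_roots_def)
qed

text \<open>With a positive inner product the difference would be a root integral at
  \<open>x\<close>. It or its negative would be outward, which decomposes \<beta> or
  \<gamma>.\<close>

lemma indecomposables_inner_nonpos:
  assumes "\<beta> \<in> indecomposables x a" "\<gamma> \<in> indecomposables x a" "\<beta> \<noteq> \<gamma>"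
  shows "\<gamma> \<bullet> \<beta> \<le> 0"
proof (rule ccontr)
  assume "\<not> \<gamma> \<bullet> \<beta> \<le> 0"
  have o: "\<beta> \<in> outward_roots x a" "\<gamma> \<in> outward_roots x a"
    using assms indecomposables_subset by auto
  then have "\<beta> - \<gamma> \<in> \<Phi>"
    using root_diff[of \<beta> \<gamma>] \<open>\<not> \<gamma> \<bullet> \<beta> \<le> 0\<close> assms(3)
    by (auto simp: outward_roots_def inner_commute)
  moreover have "(\<beta> - \<gamma>) \<bullet> x \<in> \<int>"
    using o by (auto simp: outward_roots_def inner_diff_left)
  ultimately have "\<beta> - \<gamma> \<in> outward_roots x a \<or> \<gamma> - \<beta> \<in> outward_roots x a"
    using outward_roots_cases by fastforce
  moreover have "\<beta> = \<gamma> + (\<beta> - \<gamma>)" "\<gamma> = \<beta> + (\<gamma> - \<beta>)" by auto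
  ultimately show False using assms(1,2) o unfolding indecomposables_def by blast
qed

text \<open>Here \<open>p\<close> is the projection of \<open>a - x\<close> onto the hyperplane
  orthogonal to \<beta>. Since \<open>\<beta> \<bullet> (a - x)\<close> is negative and
  indecomposables pair non-positively, the correction cannot raise the value of another
  indecomposable, which stays negative.\<close>

lemma outward_roots_neg_on_projection:
  assumes b: "\<beta> \<in> indecomposables x a" and g: "\<gamma> \<in> outward_roots x a" and "\<gamma> \<noteq> \<beta>"
  defines "p \<equiv> (a - x) - ((\<beta> \<bullet> (a - x)) / (\<beta> \<bullet> \<beta>)) *\<^sub>R \<beta>"
  shows "\<beta> \<bullet> p = 0" "\<gamma> \<bullet> p < 0"
proof -
  have neg: "\<eta> \<bullet> (a - x) < 0" if "\<eta> \<in> outward_roots x a" for \<eta>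
    using that by (auto simp: outward_roots_def inner_diff_right)
  have bo: "\<beta> \<in> outward_roots x a" and bR: "\<beta> \<in> \<Phi>" and gR: "\<gamma> \<in> \<Phi>"
    using b g by (auto simp: indecomposables_def outward_roots_def)
  have bb: "0 < \<beta> \<bullet> \<beta>" using root_nonzero[OF bR] by simp
  then show bp: "\<beta> \<bullet> p = 0" by (simp add: p_def inner_diff_right)
  have ip: "\<eta> \<bullet> p < 0" if e: "\<eta> \<in> indecomposables x a" "\<eta> \<noteq> \<beta>" for \<eta>
  proof -
    have "0 \<le> (\<beta> \<bullet> (a - x)) / (\<beta> \<bullet> \<beta>) * (\<eta> \<bullet> \<beta>)"
      using indecomposables_inner_nonpos[OF b e(1)] e(2) neg[OF bo] bb
      by (intro mult_nonpos_nonpos divide_nonpos_pos) auto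
    then show ?thesis
      using neg[of \<eta>] e(1) indecomposables_subset unfolding p_def inner_diff_right[of \<eta> "a - x"]
      by (simp del: inner_diff_right) (smt (verit) subsetD)
  qed
  obtain c :: "'a \<Rightarrow> nat" where c: "\<gamma> = (\<Sum>\<delta>\<in>indecomposables x a. real (c \<delta>) *\<^sub>R \<delta>)"
    using outward_roots_subset_span_indecomposables[OF g] unfolding nonneg_int_span_def by blast
  have fin: "finite (indecomposables x a)" by (rule finite_indecomposables)
  have gp: "\<gamma> \<bullet> p = (\<Sum>\<delta>\<in>indecomposables x a. real (c \<delta>) * (\<delta> \<bullet> p))"
    by (subst c) (simp add: inner_sum_left)
  have terms: "real (c \<delta>) * (\<delta> \<bullet> p) \<le> 0" if "\<delta> \<in> indecomposables x a" for \<delta>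
    using ip[OF that] bp by (cases "\<delta> = \<beta>") (auto simp: mult_nonneg_nonpos)
  \<comment> \<open>Otherwise \<gamma> is a multiple of \<beta>, hence its negative; but both are
    negative on \<open>a - x\<close>.\<close>
  have "\<exists>\<delta>\<in>indecomposables x a. \<delta> \<noteq> \<beta> \<and> c \<delta> \<noteq> 0"
  proof (rule ccontr)
    assume "\<not> ?thesis"
    then have "(\<Sum>\<delta>\<in>indecomposables x a. real (c \<delta>) *\<^sub>R \<delta>)
        = (\<Sum>\<delta>\<in>indecomposables x a. if \<delta> = \<beta> then real (c \<beta>) *\<^sub>R \<beta> else 0)"
      by (intro sum.cong) auto
    then have gb: "\<gamma> = real (c \<beta>) *\<^sub>R \<beta>" using c b fin by simp
    then have "\<gamma> = -\<beta>" using root_scaleR[OF bR, of "real (c \<beta>)"] gR assms(3) by auto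
    then show False using neg[OF bo] neg[OF g] by simp
  qed
  then obtain \<delta> where d: "\<delta> \<in> indecomposables x a" "\<delta> \<noteq> \<beta>" "c \<delta> \<noteq> 0" by blast
  have "real (c \<delta>) * (\<delta> \<bullet> p) < 0" using ip[OF d(1,2)] d(3) by (simp add: mult_pos_neg)
  then have "(\<Sum>\<delta>\<in>indecomposables x a. real (c \<delta>) * (\<delta> \<bullet> p)) < (\<Sum>\<delta>\<in>indecomposables x a. 0)"
    using terms d(1) fin by (intro sum_strict_mono_ex1) auto
  then show "\<gamma> \<bullet> p < 0" unfolding gp by simp
qed

text \<open>The hyperplane supports the closure because \<beta> is maximal at \<open>x\<close>. The
  face has full dimension because a short step from \<open>x\<close> along \<open>p\<close> stays in
  the hyperplane and makes all bounds of the other roots strict.\<close>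

lemma indecomposable_wall:
  assumes b: "\<beta> \<in> indecomposables x a" and m: "\<beta> \<bullet> x = of_int m"
  shows "wall alc (root_hyperplane \<beta> m)"
proof -
  let ?P = "positive_roots \<Phi> \<Delta>" and ?H = "root_hyperplane \<beta> m"
  have bo: "\<beta> \<in> outward_roots x a" and bR: "\<beta> \<in> \<Phi>"
    using b by (auto simp: indecomposables_def outward_roots_def)
  have b0: "\<beta> \<noteq> 0" using root_nonzero[OF bR] .
  have H: "?H = {y. \<beta> \<bullet> y = of_int m}" by (simp add: root_hyperplane_def)
  have le: "\<beta> \<bullet> y \<le> of_int m" if "y \<in> closure alc" for y
    using outward_roots_le[OF bo that] m by simp
  have face: "(closure alc \<inter> ?H) face_of closure alc"
    unfolding H by (intro face_of_Int_supporting_hyperplane_le convex_closure convex_cell le)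
  define p where "p = (a - x) - ((\<beta> \<bullet> (a - x)) / (\<beta> \<bullet> \<beta>)) *\<^sub>R \<beta>"
  have bp: "\<beta> \<bullet> p = 0" using b0 by (simp add: p_def inner_diff_right)
  have neg: "\<gamma> \<bullet> p < 0" if "\<gamma> \<in> outward_roots x a" "\<gamma> \<noteq> \<beta>" for \<gamma>
    unfolding p_def by (rule outward_roots_neg_on_projection(2)[OF b that])
  \<comment> \<open>Both signs are removed, as it is not known which of them is the positive
    root.\<close>
  define U where "U = cell (?P - {\<beta>, -\<beta>}) a"
  have "open U" unfolding U_def using finite_positive_roots by (intro open_cell) auto
  \<comment> \<open>A bound strict at \<open>x\<close> survives a small step by continuity. A bound
    attained at \<open>x\<close> comes from an outward root other than \<beta>, up to sign, and
    \<open>p\<close> points strictly away from it.\<close>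
  have "\<forall>\<^sub>F t in at_right (0::real). \<forall>\<alpha>\<in>?P - {\<beta>, -\<beta>}.
      of_int \<lfloor>\<alpha> \<bullet> a\<rfloor> < \<alpha> \<bullet> (x + t *\<^sub>R p) \<and> \<alpha> \<bullet> (x + t *\<^sub>R p) < of_int \<lfloor>\<alpha> \<bullet> a\<rfloor> + 1"
  proof (intro eventually_ball_finite ballI)
    show "finite (?P - {\<beta>, -\<beta>})" using finite_positive_roots by simp
    fix \<alpha> assume \<alpha>: "\<alpha> \<in> ?P - {\<beta>, -\<beta>}"
    then have \<alpha>P: "\<alpha> \<in> ?P" and \<alpha>R: "\<alpha> \<in> \<Phi>" by (auto simp: positive_roots_def)
    have lim: "((\<lambda>t. \<alpha> \<bullet> (x + t *\<^sub>R p)) \<longlongrightarrow> \<alpha> \<bullet> (x + 0 *\<^sub>R p)) (at_right 0)"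
      by (intro tendsto_intros)
    have pos: "\<forall>\<^sub>F t in at_right (0::real). 0 < t" by (rule eventually_at_right_less)
    have low: "\<forall>\<^sub>F t in at_right 0. of_int \<lfloor>\<alpha> \<bullet> a\<rfloor> < \<alpha> \<bullet> (x + t *\<^sub>R p)"
    proof (cases "of_int \<lfloor>\<alpha> \<bullet> a\<rfloor> = \<alpha> \<bullet> x")
      case False
      then show ?thesis using order_tendstoD(1)[OF lim] closure_bounds(1)[OF x \<alpha>P] by simp
    next
      case True
      then have "-\<alpha> \<in> outward_roots x a"
        using base_bounds[OF \<alpha>P] root_uminus[OF \<alpha>R]
        unfolding outward_roots_def by (auto simp flip: True)
      then have "(-\<alpha>) \<bullet> p < 0" using \<alpha> by (intro neg) auto
      then have "0 < \<alpha> \<bullet> p" by simp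
      then show ?thesis using True
        by (intro eventually_mono[OF pos]) (simp add: inner_add_right)
    qed
    have high: "\<forall>\<^sub>F t in at_right 0. \<alpha> \<bullet> (x + t *\<^sub>R p) < of_int \<lfloor>\<alpha> \<bullet> a\<rfloor> + 1"
    proof (cases "\<alpha> \<bullet> x = of_int \<lfloor>\<alpha> \<bullet> a\<rfloor> + 1")
      case False
      then show ?thesis using order_tendstoD(2)[OF lim] closure_bounds(2)[OF x \<alpha>P] by simp
    next
      case True
      then have "\<alpha> \<in> outward_roots x a"
        using base_bounds[OF \<alpha>P] \<alpha>R unfolding outward_roots_def by auto
      then have "\<alpha> \<bullet> p < 0" using \<alpha> by (intro neg) auto
      then show ?thesis using True
        by (intro eventually_mono[OF pos]) (simp add: inner_add_right mult_pos_neg)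
    qed
    show "\<forall>\<^sub>F t in at_right 0. of_int \<lfloor>\<alpha> \<bullet> a\<rfloor> < \<alpha> \<bullet> (x + t *\<^sub>R p)
        \<and> \<alpha> \<bullet> (x + t *\<^sub>R p) < of_int \<lfloor>\<alpha> \<bullet> a\<rfloor> + 1"
      using low high by (rule eventually_conj)
  qed
  then obtain t where t: "x + t *\<^sub>R p \<in> U"
    using eventually_happens'[OF trivial_limit_at_right_real] unfolding U_def cell_def by blast
  have q: "x + t *\<^sub>R p \<in> ?H" using m bp by (simp add: H inner_add_right)
  \<comment> \<open>On the hyperplane the removed roots have the same values as at \<open>x\<close>,
    so their bounds hold there too.\<close>
  have sub: "?H \<inter> U \<subseteq> closure alc \<inter> ?H"
  proof
    fix y assume y: "y \<in> ?H \<inter> U"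
    then have yx: "\<beta> \<bullet> y = \<beta> \<bullet> x" using m by (simp add: H)
    have "of_int \<lfloor>\<alpha> \<bullet> a\<rfloor> \<le> \<alpha> \<bullet> y \<and> \<alpha> \<bullet> y \<le> of_int \<lfloor>\<alpha> \<bullet> a\<rfloor> + 1" if \<alpha>: "\<alpha> \<in> ?P" for \<alpha>
    proof (cases "\<alpha> \<in> {\<beta>, -\<beta>}")
      case True
      then have "\<alpha> \<bullet> y = \<alpha> \<bullet> x" using yx by auto
      then show ?thesis using closure_bounds[OF x \<alpha>] by simp
    next
      case False
      then show ?thesis using y \<alpha> unfolding U_def cell_def by (auto intro: less_imp_le)
    qed
    then show "y \<in> closure alc \<inter> ?H" using y unfolding closure_cell[OF a] by auto
  qed
  have aff: "affine ?H" unfolding H by (rule affine_hyperplane)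
  have dH: "aff_dim ?H = DIM('a) - 1" unfolding H using b0 by (rule aff_dim_hyperplane)
  \<comment> \<open>A nonempty relatively open part of the hyperplane has its full
    dimension.\<close>
  have "aff_dim (?H \<inter> U) = aff_dim ?H"
    using t q \<open>open U\<close> aff by (intro aff_dim_convex_Int_open affine_imp_convex) auto
  then have "aff_dim (closure alc \<inter> ?H) = DIM('a) - 1"
    using aff_dim_subset[OF sub] aff_dim_subset[of "closure alc \<inter> ?H" ?H] dH by auto
  moreover have "aff_dim (closure alc) = DIM('a)"
    using a open_cell[OF finite_positive_roots] by (auto intro!: aff_dim_open)
  ultimately have "(closure alc \<inter> ?H) facet_of closure alc"
    using face x m unfolding facet_of_def by (auto simp: H)
  moreover have "\<exists>v c. v \<noteq> 0 \<and> ?H = {y. v \<bullet> y = c} \<and> (\<forall>y\<in>alc. v \<bullet> y \<le> c)"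
    using b0 H le closure_subset by blast
  ultimately show ?thesis unfolding wall_def by blast
qed

end

end

end

section \<open>From strong compatibility to Worpitzky compatibility\<close>

text \<open>The definition of a ceiling leaves the normal vector open, so the sign of
  \<open>m\<close> has to be recovered geometrically: for negative \<open>m\<close> the hyperplane
  would separate \<open>a\<close> from the origin.\<close>

lemma ceiling_of_pos:
  assumes "ceiling_of A (root_hyperplane \<beta> m)" "a \<in> A" "\<beta> \<bullet> a < of_int m"
  shows "0 < m"
proof (rule ccontr)
  assume "\<not> 0 < m"
  obtain v c where H: "root_hyperplane \<beta> m = {x. v \<bullet> x = c}"
    and lt: "insert 0 A \<subseteq> {x. v \<bullet> x < c}" and 0: "0 \<notin> root_hyperplane \<beta> m"
    using assms(1) unfolding ceiling_of_def by blast
  have m: "m < 0" using 0 \<open>\<not> 0 < m\<close> by (auto simp: root_hyperplane_def)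
  \<comment> \<open>The point \<open>t *\<^sub>R a\<close> is where the segment from the origin to
    \<open>a\<close> would cross the hyperplane.\<close>
  define t where "t = of_int m / (\<beta> \<bullet> a)"
  have t: "0 < t" "t < 1" and neg: "\<beta> \<bullet> a < 0"
  proof -
    have "real_of_int m < 0" using m by simp
    then show "\<beta> \<bullet> a < 0" "0 < t" "t < 1"
      using assms(3) by (auto simp: t_def divide_simps)
  qed
  have "t *\<^sub>R a \<in> root_hyperplane \<beta> m"
    using neg by (simp add: root_hyperplane_def t_def)
  then have eq: "t * (v \<bullet> a) = c" using H by auto
  have "0 < c" "v \<bullet> a < c" using lt assms(2) by auto
  then have "t * (v \<bullet> a) < t * c" "t * c \<le> 1 * c" using t by (auto intro: mult_right_mono)
  then show False using eq by simp
qed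

text \<open>This adapts a combination over a finite set to the definition, which wants positive
  coefficients and roots indexed from 1: zero terms are dropped and the rest is enumerated.\<close>

lemma strongly_compatible_span:
  assumes "\<Psi> \<in> strongly_compatible_sets \<Phi> \<Delta>" "\<alpha> \<in> \<Psi>" "finite B" "B \<subseteq> positive_roots \<Phi> \<Delta>"
    and \<alpha>: "\<alpha> = (\<Sum>\<delta>\<in>B. real (c \<delta>) *\<^sub>R \<delta>)"
  obtains \<beta> where "\<beta> \<in> B" "0 < c \<beta>" "\<beta> \<in> \<Psi>"
proof -
  define B' where "B' = {\<delta>\<in>B. 0 < c \<delta>}"
  have "finite B'" using assms(3) by (simp add: B'_def)
  then obtain h where h: "bij_betw h {1..card B'} B'"
    using ex_bij_betw_nat_finite_1 by blast
  then have hB: "h i \<in> B'" if "i \<in> {1..card B'}" for i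
    using that by (auto simp: bij_betw_def)
  have "\<alpha> = (\<Sum>\<delta>\<in>B'. real (c \<delta>) *\<^sub>R \<delta>)"
    unfolding \<alpha> using assms(3) by (intro sum.mono_neutral_right) (auto simp: B'_def)
  also have "\<dots> = (\<Sum>i=1..card B'. real (c (h i)) *\<^sub>R h i)"
    using sum.reindex_bij_betw[OF h, of "\<lambda>\<delta>. real (c \<delta>) *\<^sub>R \<delta>"] by simp
  finally have eq: "\<alpha> = (\<Sum>i=1..card B'. real ((c \<circ> h) i) *\<^sub>R h i)" by simp
  have "\<forall>i\<in>{1..card B'}. h i \<in> positive_roots \<Phi> \<Delta>" "\<forall>i\<in>{1..card B'}. 0 < (c \<circ> h) i"
    using hB assms(4) by (auto simp: B'_def)
  then have "\<exists>k\<in>{1..card B'}. h k \<in> \<Psi>"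
    using assms(1,2) eq unfolding strongly_compatible_sets_def by blast
  then show ?thesis using that hB unfolding B'_def by blast
qed

lemma strongly_compatible_sets_subset_worpitzky_compatible_sets:
  fixes \<Phi> \<Delta> :: "'a::euclidean_space set"
  assumes cr: "crystallographic_root_system \<Phi>" and ss: "simple_system \<Phi> \<Delta>"
  shows "strongly_compatible_sets \<Phi> \<Delta> \<subseteq> worpitzky_compatible_sets \<Phi> \<Delta>"
proof
  fix \<Psi> assume SC: "\<Psi> \<in> strongly_compatible_sets \<Phi> \<Delta>"
  then have sub: "\<Psi> \<subseteq> positive_roots \<Phi> \<Delta>" by (simp add: strongly_compatible_sets_def)
  \<comment> \<open>The point \<open>x\<close> witnesses that the intersection is nonempty. The
    choice of \<beta> depends on \<open>x\<close>, but its hyperplane will contain the whole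
    intersection.\<close>
  have "\<exists>\<beta>\<in>\<Psi>. \<exists>m'. ceiling_of A (root_hyperplane \<beta> m') \<and>
      upper_closure A \<inter> root_hyperplane \<alpha> m \<subseteq> root_hyperplane \<beta> m'"
    if A: "A \<in> alcoves \<Phi> \<Delta>" "A \<subseteq> upper_box \<Delta>" and \<alpha>: "\<alpha> \<in> \<Psi>"
      and x: "x \<in> upper_closure A" "x \<in> root_hyperplane \<alpha> m" for A \<alpha> m x
  proof -
    let ?P = "positive_roots \<Phi> \<Delta>"
    obtain a where aA: "a \<in> A"
      using A(1) in_components_nonempty unfolding alcoves_def by blast
    have cell: "A = cell ?P a" "a \<in> cell ?P a"
      using component_eq_cell[OF _ aA] A(1) unfolding alcoves_def by auto
    have uc: "upper_closure A \<subseteq> closure A"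
      using closure_subset unfolding upper_closure_def by auto
    then have xc: "x \<in> closure (cell ?P a)" using x(1) cell(1) by auto
    have "closed {y. \<forall>\<delta>\<in>\<Delta>. 0 \<le> \<delta> \<bullet> y}"
    proof -
      have "{y. \<forall>\<delta>\<in>\<Delta>. 0 \<le> \<delta> \<bullet> y} = (\<Inter>\<delta>\<in>\<Delta>. {y. \<delta> \<bullet> y \<ge> 0})" by auto
      then show ?thesis by (simp add: closed_INT closed_halfspace_ge)
    qed
    then have "closure A \<subseteq> {y. \<forall>\<delta>\<in>\<Delta>. 0 \<le> \<delta> \<bullet> y}"
      using A(2) by (intro closure_minimal) (auto simp: upper_box_def less_imp_le)
    then have dx: "0 \<le> \<delta> \<bullet> x" and da: "0 \<le> \<delta> \<bullet> a" if "\<delta> \<in> \<Delta>" for \<delta>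
      using that xc cell(1) aA closure_subset by blast+
    let ?N = "outward_roots \<Phi> x a" and ?B = "indecomposables \<Phi> x a"
    have ceil: "ceiling_of A (root_hyperplane \<beta> \<lfloor>\<beta> \<bullet> x\<rfloor>) \<and> \<beta> \<bullet> x = of_int \<lfloor>\<beta> \<bullet> x\<rfloor> \<and> \<beta> \<in> ?P"
      if b: "\<beta> \<in> ?B" for \<beta>
    proof -
      have bN: "\<beta> \<in> ?N" using b indecomposables_subset[OF cr] by blast
      then have bR: "\<beta> \<in> \<Phi>" and lt: "\<beta> \<bullet> a < \<beta> \<bullet> x" and int: "\<beta> \<bullet> x = of_int \<lfloor>\<beta> \<bullet> x\<rfloor>"
        unfolding outward_roots_def[OF cr] by (auto elim: Ints_cases)
      have "wall A (root_hyperplane \<beta> \<lfloor>\<beta> \<bullet> x\<rfloor>)"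
        using indecomposable_wall[OF cr ss cell(2) xc b int] cell(1) by simp
      moreover have "x \<in> root_hyperplane \<beta> \<lfloor>\<beta> \<bullet> x\<rfloor>" using int by (simp add: root_hyperplane_def)
      \<comment> \<open>The upper closure omits every wall that is not a ceiling, and
        \<open>x\<close> lies on this wall.\<close>
      ultimately have c: "ceiling_of A (root_hyperplane \<beta> \<lfloor>\<beta> \<bullet> x\<rfloor>)"
        using x(1) unfolding upper_closure_def by blast
      then have "0 < \<lfloor>\<beta> \<bullet> x\<rfloor>" using lt int by (intro ceiling_of_pos[OF _ aA]) auto
      then have "0 < \<beta> \<bullet> x" using int by linarith
      \<comment> \<open>Non-negative combinations of simple roots are non-negative at
        \<open>x\<close>, whereas \<open>-\<beta>\<close> is negative there.\<close>
      then have "-\<beta> \<notin> nonneg_int_span \<Delta>"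
        using nonneg_int_span_inner_nonneg[of "-\<beta>" \<Delta> x] dx by auto
      then have "\<beta> \<in> ?P" using root_positive_cases[OF cr ss bR] by (auto simp: positive_roots_def)
      then show ?thesis using c int by blast
    qed
    have \<alpha>x: "\<alpha> \<bullet> x = of_int m" using x(2) by (simp add: root_hyperplane_def)
    have \<alpha>P: "\<alpha> \<in> ?P" and \<alpha>R: "\<alpha> \<in> \<Phi>" using \<alpha> sub by (auto simp: positive_roots_def)
    \<comment> \<open>Otherwise \<open>-\<alpha>\<close> would be a combination of indecomposables,
      all positive roots and hence non-negative at \<open>a\<close>. As \<alpha> is non-negative
      there as well, \<open>a\<close> would lie on the hyperplane of \<alpha> at level 0.\<close>
    have "-\<alpha> \<notin> ?N"
    proof
      assume N: "-\<alpha> \<in> ?N"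
      then have "-\<alpha> \<in> nonneg_int_span ?B" by (rule outward_roots_subset_span_indecomposables[OF cr])
      moreover have "0 \<le> \<delta> \<bullet> a" if "\<delta> \<in> ?B" for \<delta>
        using ceil[OF that] da nonneg_int_span_inner_nonneg[of \<delta> \<Delta> a] by (auto simp: positive_roots_def)
      ultimately have "0 \<le> (-\<alpha>) \<bullet> a" by (rule nonneg_int_span_inner_nonneg)
      moreover have "0 \<le> \<alpha> \<bullet> a"
        using \<alpha>P da nonneg_int_span_inner_nonneg[of \<alpha> \<Delta>] by (auto simp: positive_roots_def)
      ultimately have "\<alpha> \<bullet> a = 0" by simp
      then show False using cell(2) \<alpha>P unfolding cell_def by force
    qed
    then have "\<alpha> \<in> ?N"
      using outward_roots_cases[OF cr ss cell(2) xc \<alpha>R] \<alpha>x by auto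
    then obtain c :: "'a \<Rightarrow> nat" where c: "\<alpha> = (\<Sum>\<delta>\<in>?B. real (c \<delta>) *\<^sub>R \<delta>)"
      using outward_roots_subset_span_indecomposables[OF cr] unfolding nonneg_int_span_def by blast
    have fin: "finite ?B" by (rule finite_indecomposables[OF cr])
    obtain \<beta> where b: "\<beta> \<in> ?B" "0 < c \<beta>" "\<beta> \<in> \<Psi>"
      using strongly_compatible_span[OF SC \<alpha> fin _ c] ceil by blast
    have "upper_closure A \<inter> root_hyperplane \<alpha> m \<subseteq> root_hyperplane \<beta> \<lfloor>\<beta> \<bullet> x\<rfloor>"
    proof
      fix y assume y: "y \<in> upper_closure A \<inter> root_hyperplane \<alpha> m"
      have le: "0 \<le> real (c \<delta>) * (\<delta> \<bullet> (x - y))" if "\<delta> \<in> ?B" for \<delta>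
      proof -
        have "\<delta> \<bullet> y \<le> \<delta> \<bullet> x"
          using outward_roots_le[OF cr ss cell(2) xc] that indecomposables_subset[OF cr] y uc cell(1)
          by blast
        then show ?thesis by (simp add: inner_diff_right)
      qed
      have "\<alpha> \<bullet> (x - y) = 0" using y \<alpha>x by (simp add: root_hyperplane_def inner_diff_right)
      \<comment> \<open>A vanishing sum of non-negative terms has only zero terms, so \<beta>, whose
        coefficient is positive, takes the same value at \<open>y\<close> as at
        \<open>x\<close>.\<close>
      then have "(\<Sum>\<delta>\<in>?B. real (c \<delta>) * (\<delta> \<bullet> (x - y))) = 0"
        by (subst (asm) c) (simp add: inner_sum_left)
      then have "real (c \<beta>) * (\<beta> \<bullet> (x - y)) = 0"
        using sum_nonneg_eq_0_iff[of ?B "\<lambda>\<delta>. real (c \<delta>) * (\<delta> \<bullet> (x - y))"] fin le b(1) by blast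
      then show "y \<in> root_hyperplane \<beta> \<lfloor>\<beta> \<bullet> x\<rfloor>"
        using b(2) ceil[OF b(1)] by (simp add: root_hyperplane_def inner_diff_right)
    qed
    then show ?thesis using ceil[OF b(1)] b(3) by blast
  qed
  then show "\<Psi> \<in> worpitzky_compatible_sets \<Phi> \<Delta>"
    using sub unfolding worpitzky_compatible_sets_def by blast
qed

theorem theorem2p3:
  fixes \<Phi> \<Delta> :: "'a::euclidean_space set"
  assumes "crystallographic_root_system \<Phi>"
    and "irreducible_root_system \<Phi>"
    and "simple_system \<Phi> \<Delta>"
  shows "root_ideals \<Phi> \<Delta> \<subseteq> strongly_compatible_sets \<Phi> \<Delta> \<and>
         strongly_compatible_sets \<Phi> \<Delta> \<subseteq> worpitzky_compatible_sets \<Phi> \<Delta>"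
  using assms root_ideals_subset_strongly_compatible_sets[of \<Phi> \<Delta>]
    strongly_compatible_sets_subset_worpitzky_compatible_sets[of \<Phi> \<Delta>]
  unfolding crystallographic_root_system_def by blast

end
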